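(* For all integers $n\geq 0$ we have $$H_n\big((2k+1)B_{2k}(\tfrac{1}{2})\big)=\prod_{\ell=1}^n\frac{\ell!^8}{(2\ell)!\,(2\ell+1)!}.$$
   Context: The Bernoulli polynomials $B_k(x)$ are defined by $\frac{te^{xt}}{e^t-1}=\sum_{k\ge 0}B_k(x)\frac{t^k}{k!}$. For a sequence $(c_0,c_1,\ldots)$ (indexed from $k=0$), $H_n(c_k)=\det\big(c_{i+j}\big)_{0\le i,j\le n}$; here $c_k=(2k+1)B_{2k}(\tfrac12)$. $\ell!^8=(\ell!)^8$, and empty products equal $1$. *)

theory Defs
  imports
    Complex_Main
    "HOL-Computational_Algebra.Formal_Power_Series"
    "Jordan_Normal_Form.Determinant"
begin

text \<open>
  The generating function of the Bernoulli polynomials is taken as an identity of formal power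
  series in t, with x a scalar; the series for exp(xt) is \<^term>\<open>fps_exp x\<close>. The denominator
  exp(t) - 1 is not a unit, but it divides t exp(xt) exactly (both have
  order at least 1, the denominator exactly 1), so the quotient below is the genuine one.
\<close>

definition bernoulli_poly :: "nat \<Rightarrow> 'a::field_char_0 \<Rightarrow> 'a" where
  "bernoulli_poly k x = fact k * fps_nth (fps_X * fps_exp x / (fps_exp 1 - 1)) k"

lemma bernoulli_poly_generating_function:
  fixes x :: "'a::field_char_0"
  shows "Abs_fps (\<lambda>k. bernoulli_poly k x / fact k) * (fps_exp 1 - 1) = fps_X * fps_exp x"
proof -
  have nz: "fps_exp 1 - 1 \<noteq> (0 :: 'a fps)"
    by (auto simp: fps_eq_iff intro!: exI[of _ 1])
  have sub: "subdegree (fps_exp 1 - 1 :: 'a fps) = 1"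
    by (intro subdegreeI) auto
  have "subdegree (fps_X * fps_exp x) = 1"
    by (intro subdegreeI) auto
  then have dvd: "(fps_exp 1 - 1) dvd (fps_X * fps_exp x)"
    using nz sub by (subst fps_dvd_iff) auto
  have "Abs_fps (\<lambda>k. bernoulli_poly k x / fact k) = fps_X * fps_exp x / (fps_exp 1 - 1)"
    by (simp add: fps_eq_iff bernoulli_poly_def)
  with dvd show ?thesis by simp
qed

text \<open>The index n is the last row index, so the matrix has n + 1 rows and columns.\<close>

definition hankel_det :: "nat \<Rightarrow> (nat \<Rightarrow> 'a::comm_ring_1) \<Rightarrow> 'a" where
  "hankel_det n c = det (mat (n + 1) (n + 1) (\<lambda>(i, j). c (i + j)))"

end

theory Submission
  imports Defs
begin

text \<open>
  With B(k, x) for the Bernoulli polynomials, the numbers (2k + 1) B(2k, 1/2) are,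
  up to the sign (-1)^k, the moments of the Wilson weight with all four parameters 1/2. Let L be the functional sending y^k to (2k + 1) B(2k, 1/2) and put
  P(n) = ((1/2)^2 - y) ((3/2)^2 - y) ... ((n - 1/2)^2 - y). If M sends s^k to B(k, 1/2), then
  M (g(s + 1/2) - g(s - 1/2)) = g'(0) and L(f) = M ((s f(s^2))'); applied to the product g of all
  m^2 - s^2 with m between 0 and n, this gives L(P(n)) = n!^2 / (n + 1). The contiguity relation
  P(i+1) P(j) - P(i) P(j+1) = (i - j) (i + j + 1) P(i) P(j) then yields
  L(P(i) P(j)) = i!^2 j!^2 / (i + j + 1), a rescaled Hilbert matrix, which the coefficients of the
  shifted Legendre polynomials bring to triangular form.
\<close>

section \<open>Linear functionals with prescribed moments\<close>

definition moment_functional :: "(nat \<Rightarrow> 'a::comm_ring_1) \<Rightarrow> 'a poly \<Rightarrow> 'a" where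
  "moment_functional c p = (\<Sum>k\<le>degree p. coeff p k * c k)"

text \<open>Coefficients beyond the degree vanish, so several polynomials can be summed over one
  common range.\<close>

lemma moment_functional_altdef:
  assumes "degree p \<le> n"
  shows "moment_functional c p = (\<Sum>k\<le>n. coeff p k * c k)"
  unfolding moment_functional_def
  by (rule sum.mono_neutral_left) (use assms in \<open>auto simp: coeff_eq_0\<close>)

lemma moment_functional_0 [simp]: "moment_functional c 0 = 0"
  by (simp add: moment_functional_def)

lemma moment_functional_add:
  "moment_functional c (p + q) = moment_functional c p + moment_functional c q"
proof -
  define n where "n = max (degree p) (degree q)"
  have "degree p \<le> n" "degree q \<le> n" "degree (p + q) \<le> n"
    unfolding n_def by (auto intro: degree_add_le_max)
  then show ?thesis
    by (simp add: moment_functional_altdef[where n = n] ring_distribs sum.distrib)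
qed

lemma moment_functional_smult:
  "moment_functional c (smult a p) = a * moment_functional c p"
  using degree_smult_le[of a p]
  by (simp add: moment_functional_altdef[where n = "degree p"] sum_distrib_left mult.assoc)

lemma moment_functional_diff:
  "moment_functional c (p - q) = moment_functional c p - moment_functional c q"
  using moment_functional_add[of c p "- q"] moment_functional_smult[of c "-1" q] by simp

lemma moment_functional_sum:
  "moment_functional c (\<Sum>i\<in>A. p i) = (\<Sum>i\<in>A. moment_functional c (p i))"
  by (induction A rule: infinite_finite_induct) (auto simp: moment_functional_add)

lemma moment_functional_monom: "moment_functional c (monom a k) = a * c k"
proof -
  have "moment_functional c (monom a k) = (\<Sum>i\<le>k. coeff (monom a k) i * c i)"
    by (rule moment_functional_altdef) (rule degree_monom_le)
  also have "\<dots> = (\<Sum>i\<le>k. if i = k then a * c k else 0)"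
    by (intro sum.cong) auto
  finally show ?thesis by simp
qed

lemma moment_functional_mult:
  assumes "degree p \<le> n" "degree q \<le> n"
  shows "moment_functional c (p * q) =
    (\<Sum>k\<le>n. \<Sum>l\<le>n. coeff p k * c (k + l) * coeff q l)"
proof -
  have "p * q = (\<Sum>k\<le>n. monom (coeff p k) k) * (\<Sum>l\<le>n. monom (coeff q l) l)"
    using assms by (simp add: poly_as_sum_of_monoms')
  also have "\<dots> = (\<Sum>k\<le>n. \<Sum>l\<le>n. monom (coeff p k * coeff q l) (k + l))"
    by (simp add: sum_product mult_monom)
  finally show ?thesis
    by (simp add: moment_functional_sum moment_functional_monom mult_ac)
qed

text \<open>The matrix on the left is the Hankel matrix multiplied by triangular coefficient
  matrices on both sides, so only their diagonals enter. Two families are allowed because the left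
  and right bases will differ.\<close>

lemma det_moment_functional_mult:
  fixes p q :: "nat \<Rightarrow> 'a::idom poly"
  assumes "\<And>i. degree (p i) \<le> i" "\<And>i. degree (q i) \<le> i"
  shows "det (mat (n + 1) (n + 1) (\<lambda>(i, j). moment_functional c (p i * q j))) =
    (\<Prod>i\<le>n. coeff (p i) i * coeff (q i) i) * hankel_det n c"
proof -
  define A where "A = mat (n + 1) (n + 1) (\<lambda>(i, j). coeff (p i) j)"
  define B where "B = mat (n + 1) (n + 1) (\<lambda>(i, j). coeff (q j) i)"
  define H where "H = mat (n + 1) (n + 1) (\<lambda>(i, j). c (i + j))"
  have carrier: "A \<in> carrier_mat (n + 1) (n + 1)" "B \<in> carrier_mat (n + 1) (n + 1)"
    "H \<in> carrier_mat (n + 1) (n + 1)"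
    by (simp_all add: A_def B_def H_def)
  have "mat (n + 1) (n + 1) (\<lambda>(i, j). moment_functional c (p i * q j)) = A * (H * B)"
  proof (rule eq_matI)
    fix i j assume "i < dim_row (A * (H * B))" "j < dim_col (A * (H * B))"
    then have ij: "i \<le> n" "j \<le> n" by (simp_all add: A_def B_def)
    have deg: "degree (p i) \<le> n" "degree (q j) \<le> n"
      using assms[of i] assms[of j] ij by auto
    show "mat (n + 1) (n + 1) (\<lambda>(i, j). moment_functional c (p i * q j)) $$ (i, j) =
        (A * (H * B)) $$ (i, j)"
      using ij by (simp add: A_def B_def H_def scalar_prod_def moment_functional_mult[OF deg]
          atLeast0LessThan lessThan_Suc_atMost sum_distrib_left mult.assoc)
  qed (simp_all add: A_def B_def)
  also have "det \<dots> = det A * (det H * det B)"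
    using carrier by (subst det_mult[of _ "n + 1"] | simp)+
  also have "det A = (\<Prod>i\<le>n. coeff (p i) i)"
  proof -
    have "det A = prod_list (diag_mat A)"
      by (rule det_lower_triangular[OF _ carrier(1)])
        (auto simp: A_def intro!: coeff_eq_0 le_less_trans[OF assms(1)])
    also have "\<dots> = (\<Prod>i\<le>n. coeff (p i) i)"
      by (simp add: prod_list_diag_prod A_def atLeast0LessThan lessThan_Suc_atMost)
    finally show ?thesis .
  qed
  also have "det B = (\<Prod>i\<le>n. coeff (q i) i)"
  proof -
    have "det B = prod_list (diag_mat B)"
      by (rule det_upper_triangular[OF upper_triangularI carrier(2)])
        (auto simp: B_def intro!: coeff_eq_0 le_less_trans[OF assms(2)])
    also have "\<dots> = (\<Prod>i\<le>n. coeff (q i) i)"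
      by (simp add: prod_list_diag_prod B_def atLeast0LessThan lessThan_Suc_atMost)
    finally show ?thesis .
  qed
  finally show ?thesis
    by (simp add: H_def hankel_det_def prod.distrib)
qed

text \<open>By the binomial theorem the left side is a binomial convolution of the moments with the
  powers of \<open>t\<close>, hence a coefficient of a product of exponential generating
  functions.\<close>

lemma moment_functional_linear_power:
  fixes t :: "'a::field_char_0"
  shows "moment_functional b ([:t, 1:] ^ k) =
    fact k * fps_nth (Abs_fps (\<lambda>k. b k / fact k) * fps_exp t) k"
proof -
  have "[:t, 1:] ^ k = (monom 1 1 + [:t:]) ^ k"
    by (simp add: monom_altdef)
  also have "\<dots> = (\<Sum>i\<le>k. monom (of_nat (k choose i) * t ^ (k - i)) i)"
    unfolding binomial_ring
    by (intro sum.cong)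
      (simp_all add: monom_power poly_const_pow of_nat_poly smult_monom mult_ac)
  finally have "moment_functional b ([:t, 1:] ^ k) =
      (\<Sum>i\<le>k. of_nat (k choose i) * t ^ (k - i) * b i)"
    by (simp add: moment_functional_sum moment_functional_monom)
  also have "\<dots> = fact k * fps_nth (Abs_fps (\<lambda>k. b k / fact k) * fps_exp t) k"
    by (auto simp: fps_mult_nth sum_distrib_left atLeast0AtMost binomial_fact
        intro!: sum.cong)
  finally show ?thesis .
qed

section \<open>The Wilson functional\<close>

abbreviation bernoulli_functional :: "real poly \<Rightarrow> real" where
  "bernoulli_functional \<equiv> moment_functional (\<lambda>k. bernoulli_poly k (1 / 2))"

text \<open>Central differencing multiplies the exponential generating function of the moments by
  exp(t/2) - exp(-t/2), and the product is exactly t. So the k-th power yields 1 for k = 1 and 0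
  otherwise; linearity does the rest.\<close>

lemma bernoulli_functional_central_difference:
  "bernoulli_functional (p \<circ>\<^sub>p [:1/2, 1:] - p \<circ>\<^sub>p [:-1/2, 1:]) = coeff p 1"
proof -
  define F :: "real fps" where "F = Abs_fps (\<lambda>k. bernoulli_poly k (1/2) / fact k)"
  have "(fps_exp (1/2) - fps_exp (-1/2) :: real fps) = fps_exp (-1/2) * (fps_exp 1 - 1)"
    by (simp add: right_diff_distrib flip: fps_exp_add_mult)
  then have "F * (fps_exp (1/2) - fps_exp (-1/2)) =
      fps_exp (-1/2) * (F * (fps_exp 1 - 1))"
    by (simp only: mult_ac)
  also have "\<dots> = fps_exp (-1/2) * (fps_X * fps_exp (1/2))"
    unfolding F_def by (subst bernoulli_poly_generating_function) simp
  also have "\<dots> = fps_X * (fps_exp (-1/2) * fps_exp (1/2))"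
    by (simp only: mult_ac)
  finally have F: "F * (fps_exp (1/2) - fps_exp (-1/2)) = fps_X"
    by (simp flip: fps_exp_add_mult)
  have pow: "bernoulli_functional ([:1/2, 1:] ^ k - [:-1/2, 1:] ^ k) = (if k = 1 then 1 else 0)"
    for k
  proof -
    have "bernoulli_functional ([:1/2, 1:] ^ k - [:-1/2, 1:] ^ k) =
        fact k * fps_nth (F * (fps_exp (1/2) - fps_exp (-1/2))) k"
      unfolding moment_functional_diff moment_functional_linear_power F_def right_diff_distrib
      by (simp add: right_diff_distrib)
    then show ?thesis by (simp only: F) simp
  qed
  have "p \<circ>\<^sub>p [:1/2, 1:] - p \<circ>\<^sub>p [:-1/2, 1:] =
      (\<Sum>k\<le>degree p. smult (coeff p k) ([:1/2, 1:] ^ k - [:-1/2, 1:] ^ k))"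
    by (simp add: pcompose_altdef poly_altdef coeff_map_poly degree_map_poly sum_subtractf
        smult_diff_right)
  then have "bernoulli_functional (p \<circ>\<^sub>p [:1/2, 1:] - p \<circ>\<^sub>p [:-1/2, 1:]) =
      (\<Sum>k\<le>degree p. coeff p k * (if k = 1 then 1 else 0))"
    by (simp only: moment_functional_sum moment_functional_smult pow)
  also have "\<dots> = coeff p 1"
    by (auto simp: if_distrib coeff_eq_0 sum.delta cong: if_cong)
  finally show ?thesis .
qed

abbreviation wilson_functional :: "real poly \<Rightarrow> real" where
  "wilson_functional \<equiv>
    moment_functional (\<lambda>k. (2 * real k + 1) * bernoulli_poly (2 * k) (1 / 2))"

text \<open>With y = s^2, differentiating s^(2k+1) supplies the weight 2k + 1.\<close>

lemma wilson_functional_eq_bernoulli_functional: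
  "wilson_functional f = bernoulli_functional (pderiv (pCons 0 (f \<circ>\<^sub>p [:0, 0, 1:])))"
proof -
  have "f \<circ>\<^sub>p [:0, 0, 1:] = (\<Sum>k\<le>degree f. monom (coeff f k) (2 * k))"
  proof -
    have "[:0, 0, 1:] ^ k = (monom 1 (2 * k) :: real poly)" for k
    proof -
      have "[:0, 0, 1:] = (monom 1 2 :: real poly)"
        by (simp add: monom_altdef numeral_2_eq_2)
      then show ?thesis by (simp add: monom_power mult.commute)
    qed
    then show ?thesis
      by (simp add: pcompose_altdef poly_altdef coeff_map_poly degree_map_poly smult_monom)
  qed
  then have "pderiv (pCons 0 (f \<circ>\<^sub>p [:0, 0, 1:])) =
      (\<Sum>k\<le>degree f. monom ((2 * real k + 1) * coeff f k) (2 * k))"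
    by (intro poly_eqI)
      (auto simp: coeff_pderiv coeff_sum sum_distrib_left add_ac intro!: sum.cong)
  then show ?thesis
    by (simp add: moment_functional_sum moment_functional_monom)
      (simp add: moment_functional_def mult_ac)
qed

text \<open>At y = s^2 this is (1/2 - s)_n (1/2 + s)_n in rising factorials.\<close>

definition wilson_basis :: "nat \<Rightarrow> real poly" where
  "wilson_basis n = (\<Prod>m<n. [:(real m + 1/2)\<^sup>2, -1:])"

lemma wilson_basis_Suc: "wilson_basis (Suc n) = [:(real n + 1/2)\<^sup>2, -1:] * wilson_basis n"
  by (simp add: wilson_basis_def mult.commute)

lemma degree_wilson_basis: "degree (wilson_basis n) = n"
  unfolding wilson_basis_def by (subst degree_prod_eq_sum_degree) auto

lemma coeff_wilson_basis: "coeff (wilson_basis n) n = (-1) ^ n"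
proof -
  have "lead_coeff (wilson_basis n) = (-1) ^ n"
    unfolding wilson_basis_def lead_coeff_prod by simp
  then show ?thesis by (simp add: degree_wilson_basis)
qed

text \<open>Once the differences of squares are split, both products run through the same linear
  factors, except for the two written in front on the right.\<close>

lemma prod_central_factorial_shift:
  fixes x :: real
  shows "(\<Prod>m\<le>n. (real m)\<^sup>2 - (x + 1/2)\<^sup>2) =
    - (x + 1/2) * (x + real n + 1/2) * (\<Prod>m<n. (real m + 1/2)\<^sup>2 - x\<^sup>2)"
proof (induction n)
  case (Suc n)
  define P where "P = (\<Prod>m<n. (real m + 1/2)\<^sup>2 - x\<^sup>2)"
  show ?case
    unfolding prod.atMost_Suc prod.lessThan_Suc Suc P_def[symmetric]
    by (simp add: power2_eq_square field_simps)
qed (simp add: power2_eq_square algebra_simps)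

lemma wilson_functional_wilson_basis:
  "wilson_functional (wilson_basis n) = (fact n)\<^sup>2 / (real n + 1)"
proof -
  define g :: "real poly" where "g = (\<Prod>m\<le>n. [:(real m)\<^sup>2, 0, -1:])"
  define f where "f = pCons 0 (wilson_basis n \<circ>\<^sub>p [:0, 0, 1:])"
  \<comment> \<open>The constant arises from (x - 1/2)(x - n - 1/2) - (x + 1/2)(x + n + 1/2) = -2(n
    + 1)x.\<close>
  have g: "g \<circ>\<^sub>p [:1/2, 1:] - g \<circ>\<^sub>p [:-1/2, 1:] = smult (- 2 * (real n + 1)) f"
  proof (rule poly_ext)
    fix x
    have g: "poly g y = (\<Prod>m\<le>n. (real m)\<^sup>2 - y\<^sup>2)" for y
      by (simp add: g_def poly_prod power2_eq_square)
    \<comment> \<open>Evenness of \<open>g\<close> turns the backward shift at x into the forward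
      shift at -x.\<close>
    have "poly g (x - 1/2) = poly g (- x + 1/2)"
      unfolding g by (simp add: power2_commute)
    then show "poly (g \<circ>\<^sub>p [:1/2, 1:] - g \<circ>\<^sub>p [:-1/2, 1:]) x =
        poly (smult (- 2 * (real n + 1)) f) x"
      using prod_central_factorial_shift[where x = x and n = n]
        prod_central_factorial_shift[where x = "- x" and n = n]
      by (simp add: g f_def wilson_basis_def poly_pcompose poly_prod power2_eq_square algebra_simps)
  qed
  have "- 2 * (real n + 1) * wilson_functional (wilson_basis n) =
      bernoulli_functional (pderiv (smult (- 2 * (real n + 1)) f))"
    unfolding wilson_functional_eq_bernoulli_functional f_def
    by (simp only: pderiv_smult moment_functional_smult)
  \<comment> \<open>Differentiation commutes with shifts, so this is the central difference of
    \<open>pderiv g\<close>.\<close>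
  also have "pderiv (smult (- 2 * (real n + 1)) f) =
      pderiv g \<circ>\<^sub>p [:1/2, 1:] - pderiv g \<circ>\<^sub>p [:-1/2, 1:]"
    unfolding g[symmetric] by (simp add: pderiv_diff pderiv_pcompose pderiv_pCons)
  also have "bernoulli_functional \<dots> = coeff (pderiv g) 1"
    by (rule bernoulli_functional_central_difference)
  also have "\<dots> = 2 * coeff g 2"
    by (simp add: coeff_pderiv numeral_2_eq_2)
  also have "coeff g 2 = - (fact n)\<^sup>2"
  proof -
    \<comment> \<open>The factor of \<open>g\<close> for m = 0 is -s^2; splitting it off leaves the
      constant term of \<open>h\<close> to compute.\<close>
    define h :: "real poly" where "h = (\<Prod>m=1..n. [:(real m)\<^sup>2, 0, -1:])"
    have "{..n} = insert 0 {1..n}" by auto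
    then have "g = [:0, 0, -1:] * h"
      by (simp add: g_def h_def)
    then have "coeff g 2 = - poly h 0"
      by (simp add: numeral_2_eq_2 poly_0_coeff_0)
    also have "poly h 0 = (fact n)\<^sup>2"
      by (simp add: h_def poly_prod fact_prod prod_power_distrib)
    finally show ?thesis .
  qed
  finally show ?thesis by (simp add: field_simps)
qed

text \<open>Each induction step moves one factor from the second basis element to the first, which
  is why \<open>i\<close> stays arbitrary. The correction term comes from (i + 1/2)^2 - (j + 1/2)^2
  = (i - j)(i + j + 1).\<close>

lemma wilson_functional_wilson_basis_mult:
  "wilson_functional (wilson_basis i * wilson_basis j) =
    (fact i)\<^sup>2 * (fact j)\<^sup>2 / (real i + real j + 1)"
proof (induction j arbitrary: i)
  case 0
  show ?case
    using wilson_functional_wilson_basis[of i] by (simp add: wilson_basis_def)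
next
  case (Suc j)
  have "wilson_basis i * wilson_basis (Suc j) = wilson_basis (Suc i) * wilson_basis j -
      smult ((real i - real j) * (real i + real j + 1)) (wilson_basis i * wilson_basis j)"
    by (simp add: wilson_basis_Suc algebra_simps power2_eq_square smult_add_left smult_diff_left)
  then have "wilson_functional (wilson_basis i * wilson_basis (Suc j)) =
      (fact (Suc i))\<^sup>2 * (fact j)\<^sup>2 / (real (Suc i) + real j + 1) -
      (real i - real j) * (real i + real j + 1) *
        ((fact i)\<^sup>2 * (fact j)\<^sup>2 / (real i + real j + 1))"
    by (simp only: moment_functional_diff moment_functional_smult Suc.IH)
  also have "\<dots> = (fact i)\<^sup>2 * (fact j)\<^sup>2 *
      ((real i + 1)\<^sup>2 / (real i + real j + 2) - (real i - real j))"
  proof -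
    have "real i + real j + 1 \<noteq> 0" by simp
    then show ?thesis
      by (simp add: right_diff_distrib power_mult_distrib add_ac mult_ac)
  qed
  also have "(real i + 1)\<^sup>2 / (real i + real j + 2) - (real i - real j) =
      (real j + 1)\<^sup>2 / (real i + real j + 2)"
    by (simp add: field_simps power2_eq_square)
  finally show ?case
    by (simp add: field_simps power2_eq_square)
qed

section \<open>Shifted Legendre coefficients\<close>

text \<open>The coefficient of x^k in the Legendre polynomial of degree j at 1 - 2x.\<close>

definition legendre_coeff :: "nat \<Rightarrow> nat \<Rightarrow> real" where
  "legendre_coeff j k = (-1) ^ k * real ((j choose k) * ((j + k) choose k))"

lemma legendre_coeff_eq_0: "j < k \<Longrightarrow> legendre_coeff j k = 0"
  by (simp add: legendre_coeff_def)

lemma legendre_coeff_altdef: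
  "k \<le> j \<Longrightarrow> legendre_coeff j k = (-1) ^ k * fact (j + k) / ((fact k)\<^sup>2 * fact (j - k))"
  by (simp add: legendre_coeff_def binomial_fact power2_eq_square)

text \<open>This ratio and the one in \<open>legendre_coeff_Suc_left\<close> are cleared of
  denominators, so that they also cover vanishing coefficients.\<close>

lemma legendre_coeff_Suc_right:
  "(real k + 1)\<^sup>2 * legendre_coeff j (Suc k) =
    - (real j + real k + 1) * (real j - real k) * legendre_coeff j k"
proof (cases "k < j")
  case True
  then obtain d where j: "j = Suc (k + d)"
    using less_imp_Suc_add by blast
  have "real k + 1 \<noteq> 0" "real d + 1 \<noteq> 0" by simp_all
  then show ?thesis
    by (simp add: j legendre_coeff_altdef power_mult_distrib divide_simps)
      (simp add: algebra_simps)
next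
  case False
  then show ?thesis
    by (cases "k = j") (auto simp: legendre_coeff_eq_0)
qed

lemma legendre_coeff_Suc_left:
  "(real j + 1 - real k) * legendre_coeff (Suc j) k = (real j + 1 + real k) * legendre_coeff j k"
proof (cases "k \<le> j")
  case True
  then obtain d where j: "j = k + d"
    using le_Suc_ex by blast
  have "real d + 1 \<noteq> 0" by simp
  then show ?thesis
    by (simp add: j legendre_coeff_altdef Suc_diff_le divide_simps)
      (simp add: algebra_simps)
next
  case False
  then show ?thesis
    by (cases "k = Suc j") (auto simp: legendre_coeff_eq_0)
qed

text \<open>A closed form for partial sums makes the claim provable by induction on
  \<open>K\<close>; it vanishes once \<open>K\<close> exceeds \<open>j\<close>.\<close>

lemma sum_legendre_coeff_add_Suc:
  "(real j + 1) * (\<Sum>k\<le>K. legendre_coeff (Suc j) k + legendre_coeff j k) =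
    2 * (real j + real K + 1) * legendre_coeff j K"
proof (induction K)
  case 0
  show ?case by (simp add: legendre_coeff_def)
next
  case (Suc K)
  show ?case
  \<comment> \<open>The general step cancels the factor j - K, so K = j is checked on explicit
    leading coefficients.\<close>
  proof (cases "K = j")
    case True
    have "(real j + 1) * legendre_coeff (Suc j) (Suc j) = - 2 * (2 * real j + 1) * legendre_coeff j j"
    proof -
      have "real j + 1 \<noteq> 0" by simp
      then show ?thesis
        by (simp add: legendre_coeff_altdef power_mult_distrib power2_eq_square divide_simps)
          (simp add: algebra_simps)
    qed
    with Suc.IH True show ?thesis
      by (simp add: legendre_coeff_eq_0 ring_distribs)
  next
    case False
    define r s t where "r = legendre_coeff (Suc j) (Suc K)" "s = legendre_coeff j (Suc K)"
      "t = legendre_coeff j K"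
    have r: "(real j - real K) * r = (real j + real K + 2) * s"
      using legendre_coeff_Suc_left[of j "Suc K"] by (simp add: r_s_t_def add_ac)
    have s: "(real K + 1)\<^sup>2 * s = - (real j + real K + 1) * (real j - real K) * t"
      unfolding r_s_t_def by (rule legendre_coeff_Suc_right)
    have "(real j - real K) * (2 * (real j + real K + 1) * t + (real j + 1) * (r + s)) =
        (real j + 1) * ((real j - real K) * r + (real j - real K) * s) -
        2 * (- (real j + real K + 1) * (real j - real K) * t)"
      by (simp add: algebra_simps)
    also have "\<dots> = (real j - real K) * (2 * (real j + real K + 2) * s)"
      unfolding r s[symmetric] by (simp add: algebra_simps power2_eq_square)
    finally have "(real j - real K) * (2 * (real j + real K + 1) * t + (real j + 1) * (r + s)) =
        (real j - real K) * (2 * (real j + real K + 2) * s)" .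
    with False have "2 * (real j + real K + 1) * t + (real j + 1) * (r + s) =
        2 * (real j + real K + 2) * s"
      by simp
    with Suc.IH show ?thesis
      by (simp add: r_s_t_def ring_distribs)
  qed
qed

text \<open>The Legendre polynomial of degree j takes the value (-1)^j at -1, so consecutive full
  sums are opposite.\<close>

lemma sum_legendre_coeff_Suc_eq_minus:
  "(\<Sum>k\<le>Suc j. legendre_coeff (Suc j) k) = - (\<Sum>k\<le>Suc j. legendre_coeff j k)"
  using sum_legendre_coeff_add_Suc[of j "Suc j"]
  by (simp add: legendre_coeff_eq_0 sum.distrib add_eq_0_iff2 del: sum.atMost_Suc)

text \<open>
  Both sides satisfy the same first-order recurrence in j: writing x + j + 1 = (x + k) + (j + 1 - k)
  and j + 1 - x = (j + 1 + k) - (x + k), the terms with denominator x + k cancel.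
\<close>

lemma sum_legendre_coeff_div:
  fixes x :: real
  assumes "x > 0"
  shows "(\<Sum>k\<le>j. legendre_coeff j k / (x + real k)) = pochhammer (1 - x) j / pochhammer x (Suc j)"
proof (induction j)
  case 0
  show ?case by (simp add: legendre_coeff_def)
next
  case (Suc j)
  have "(x + real j + 1) * (legendre_coeff (Suc j) k / (x + real k)) -
      (real j + 1 - x) * (legendre_coeff j k / (x + real k)) =
      legendre_coeff (Suc j) k + legendre_coeff j k" for k
  proof -
    have "(x + real j + 1) * (legendre_coeff (Suc j) k / (x + real k)) -
        (real j + 1 - x) * (legendre_coeff j k / (x + real k)) =
        ((x + real k) * (legendre_coeff (Suc j) k + legendre_coeff j k) +
          ((real j + 1 - real k) * legendre_coeff (Suc j) k -
            (real j + 1 + real k) * legendre_coeff j k)) / (x + real k)"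
      by (simp add: algebra_simps diff_divide_distrib add_divide_distrib)
    moreover have "x + real k \<noteq> 0" using assms by simp
    ultimately show ?thesis
      by (simp add: legendre_coeff_Suc_left)
  qed
  then have "(x + real j + 1) * (\<Sum>k\<le>Suc j. legendre_coeff (Suc j) k / (x + real k)) -
      (real j + 1 - x) * (\<Sum>k\<le>Suc j. legendre_coeff j k / (x + real k)) =
      (\<Sum>k\<le>Suc j. legendre_coeff (Suc j) k + legendre_coeff j k)"
    by (simp only: sum_distrib_left sum_subtractf[symmetric])
  also have "\<dots> = 0"
    using sum_legendre_coeff_Suc_eq_minus by (simp add: sum.distrib del: sum.atMost_Suc)
  \<comment> \<open>The sum for \<open>j\<close> ends in a zero term at k = j + 1, so the induction
    hypothesis applies.\<close>
  finally have "(x + real j + 1) * (\<Sum>k\<le>Suc j. legendre_coeff (Suc j) k / (x + real k)) =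
      (real j + 1 - x) * (pochhammer (1 - x) j / pochhammer x (Suc j))"
    using Suc.IH legendre_coeff_eq_0[of j "Suc j"] by simp
  moreover have "x + real j + 1 \<noteq> 0"
    using assms by simp
  ultimately have "(\<Sum>k\<le>Suc j. legendre_coeff (Suc j) k / (x + real k)) =
      (real j + 1 - x) * (pochhammer (1 - x) j / pochhammer x (Suc j)) / (x + real j + 1)"
    by (metis nonzero_mult_div_cancel_left)
  then show ?case
    by (simp only: pochhammer_Suc[of x "Suc j"] pochhammer_Suc[of "1 - x" j])
      (simp add: algebra_simps)
qed

section \<open>The Hankel determinant\<close>

theorem corollary5p4:
  fixes n :: nat
  shows "hankel_det n (\<lambda>k. (2 * real k + 1) * bernoulli_poly (2 * k) (1 / 2)) =
    (\<Prod>l = 1..n. fact l ^ 8 / (fact (2 * l) * fact (2 * l + 1)))"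
proof -
  \<comment> \<open>Dividing by k!^2 cancels that factor of the moments and leaves Legendre
    combinations of the Hilbert entries 1 / (i + k + 1).\<close>
  define q where "q j = (\<Sum>k\<le>j. smult (legendre_coeff j k / (fact k)\<^sup>2) (wilson_basis k))" for j
  define D where "D = mat (n + 1) (n + 1)
    (\<lambda>(i, j). wilson_functional (wilson_basis i * q j))"
  have deg: "degree (q j) \<le> j" for j
    unfolding q_def
    by (intro degree_sum_le) (auto intro: order.trans[OF degree_smult_le] simp: degree_wilson_basis)
  have lead: "coeff (q j) j = fact (2 * j) / fact j ^ 4" for j
  proof -
    have "coeff (q j) j = (\<Sum>k\<le>j. if k = j then legendre_coeff j j / (fact j)\<^sup>2 * (-1) ^ j else 0)"
      unfolding q_def coeff_sum
      by (intro sum.cong) (auto simp: coeff_wilson_basis degree_wilson_basis intro!: coeff_eq_0)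
    moreover have "legendre_coeff j j = (-1) ^ j * fact (2 * j) / (fact j)\<^sup>2"
      by (simp add: legendre_coeff_altdef mult_2)
    moreover have "(-1 :: real) ^ j * (-1) ^ j = 1"
      by (simp flip: power_mult_distrib)
    ultimately show ?thesis
      by (simp add: power2_eq_square power4_eq_xxxx mult_ac)
  qed
  \<comment> \<open>This is the partial fraction sum at x = i + 1. Its numerator
    \<open>pochhammer (- real i) j\<close> vanishes for i < j, which makes \<open>D\<close> lower
    triangular.\<close>
  have D: "wilson_functional (wilson_basis i * q j) =
      (fact i)\<^sup>2 * (pochhammer (- real i) j / pochhammer (real i + 1) (Suc j))" for i j
  proof -
    have "wilson_functional (wilson_basis i * q j) =
        (fact i)\<^sup>2 * (\<Sum>k\<le>j. legendre_coeff j k / (real i + 1 + real k))"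
      unfolding q_def sum_distrib_left mult_smult_right moment_functional_sum
        moment_functional_smult wilson_functional_wilson_basis_mult
      by (simp add: add_ac mult.commute)
    then show ?thesis
      using sum_legendre_coeff_div[of "real i + 1" j] by simp
  qed
  have diag: "wilson_functional (wilson_basis i * q i) =
      (-1) ^ i * fact i ^ 4 / fact (2 * i + 1)" for i
  proof -
    have "fact i * pochhammer (real i + 1) (Suc i) = fact (2 * i + 1)"
      using pochhammer_product'[of "1 :: real" i "Suc i"]
      by (simp add: pochhammer_fact mult_2 add_ac)
    then have *: "pochhammer (real i + 1) (Suc i) = fact (2 * i + 1) / fact i"
      by (simp add: eq_divide_eq mult.commute del: fact_Suc)
    show ?thesis
      unfolding D * pochhammer_same
      by (simp add: power2_eq_square power4_eq_xxxx mult_ac del: fact_Suc)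
  qed
  have "det D = prod_list (diag_mat D)"
    by (rule det_lower_triangular[of "n + 1"]) (auto simp: D_def D pochhammer_of_nat_eq_0_iff)
  also have "\<dots> = (\<Prod>i\<le>n. (-1) ^ i * fact i ^ 4 / fact (2 * i + 1))"
    by (simp add: prod_list_diag_prod D_def diag atLeast0LessThan lessThan_Suc_atMost
        del: fact_Suc)
  finally have "(\<Prod>i\<le>n. (-1) ^ i * fact i ^ 4 / fact (2 * i + 1)) =
      (\<Prod>i\<le>n. (-1) ^ i * (fact (2 * i) / fact i ^ 4)) *
      hankel_det n (\<lambda>k. (2 * real k + 1) * bernoulli_poly (2 * k) (1 / 2))"
    unfolding D_def
    by (subst (asm) det_moment_functional_mult)
      (simp_all add: deg lead coeff_wilson_basis degree_wilson_basis del: fact_Suc)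
  \<comment> \<open>All leading coefficients are nonzero, so their product can be divided
    out.\<close>
  then have "hankel_det n (\<lambda>k. (2 * real k + 1) * bernoulli_poly (2 * k) (1 / 2)) =
      (\<Prod>i\<le>n. (-1) ^ i * fact i ^ 4 / fact (2 * i + 1)) /
      (\<Prod>i\<le>n. (-1) ^ i * (fact (2 * i) / fact i ^ 4))"
    by (simp add: field_simps)
  also have "\<dots> = (\<Prod>l\<le>n. fact l ^ 8 / (fact (2 * l) * fact (2 * l + 1)))"
    unfolding prod_dividef[symmetric]
    by (intro prod.cong) (auto simp: field_simps simp flip: power_add simp del: fact_Suc)
  \<comment> \<open>The factor for l = 0 equals 1.\<close>
  also have "\<dots> = (\<Prod>l = 1..n. fact l ^ 8 / (fact (2 * l) * fact (2 * l + 1)))"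
    by (rule prod.mono_neutral_right) (auto simp: not_less_eq_eq)
  finally show ?thesis .
qed

end
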